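(* For each integer $n\ge1$, there exists a mapping $f_n\colon \mathcal{L}_n\to L_1[0,1]$ such that, for all $a,b\in\mathcal{L}_n$, $$\frac34 d(a,b)\le \|f_n(a)-f_n(b)\|_1\le d(a,b),$$ where $\mathcal{L}_n$ denotes (the vertex set of) the Laakso graph of level $n$ and $d$ is its shortest-path metric.
   Context: Laakso graphs: $\mathcal{L}_0$ has two vertices joined by an edge. $\mathcal{L}_1$ is the graph with six vertices $A,T,L,R,B,U$ and six edges $AT$, $TL$, $TR$, $LB$, $RB$, $BU$. For $n\ge1$, $\mathcal{L}_n$ is obtained from $\mathcal{L}_{n-1}$ by replacing each edge $uv$ of $\mathcal{L}_{n-1}$ by a copy of $\mathcal{L}_1$, with $u$ and $v$ identified with the vertices $A$ and $U$ of the copy (the other four vertices of each copy being new; which endpoint plays the role of $A$ does not matter, up to isomorphism, by symmetry). Every edge of $\mathcal{L}_n$ has length $1$, and $\mathcal{L}_n$ is regarded as a metric space on its vertex set with the shortest-path metric $d$. $L_1[0,1]$ is taken with respect to Lebesgue measure. *)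

theory Defs
  imports "HOL-Analysis.Analysis" "Graph_Theory.Graph_Theory"
begin

datatype laakso_pos = LA | LT | LL | LR | LB | LU

definition laakso_template :: "laakso_pos rel" where
  "laakso_template = {(LA, LT), (LT, LL), (LT, LR), (LL, LB), (LR, LB), (LB, LU)}"

datatype laakso_vertex =
    Source
  | Sink
  | New nat laakso_vertex laakso_vertex laakso_pos

text \<open>
  The copy of the template that replaces the edge \<open>uv\<close> when passing from level \<open>n\<close> to level
  \<open>n + 1\<close>: the positions \<open>LA\<close> and \<open>LU\<close> are identified with \<open>u\<close> and \<open>v\<close>, while the four inner
  positions get vertices tagged with \<open>n\<close>, \<open>u\<close> and \<open>v\<close>, so that they differ from all vertices
  of level \<open>n\<close> and from those of the other copies.
\<close>

fun laakso_glue :: "nat \<Rightarrow> laakso_vertex \<Rightarrow> laakso_vertex \<Rightarrow> laakso_pos \<Rightarrow> laakso_vertex" where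
  "laakso_glue n u v LA = u"
| "laakso_glue n u v LU = v"
| "laakso_glue n u v x = New n u v x"

text \<open>
  Each undirected edge is listed here in exactly one orientation, from the \<open>LA\<close> side to the
  \<open>LU\<close> side; this fixes which endpoint plays the role of \<open>LA\<close> at the next level.
\<close>

fun laakso_edges :: "nat \<Rightarrow> laakso_vertex rel" where
  "laakso_edges 0 = {(Source, Sink)}"
| "laakso_edges (Suc n) =
    {(laakso_glue n u v x, laakso_glue n u v y) | u v x y.
       (u, v) \<in> laakso_edges n \<and> (x, y) \<in> laakso_template}"

fun laakso_verts :: "nat \<Rightarrow> laakso_vertex set" where
  "laakso_verts 0 = {Source, Sink}"
| "laakso_verts (Suc n) =
    laakso_verts n \<union> {laakso_glue n u v x | u v x. (u, v) \<in> laakso_edges n}"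

definition laakso :: "nat \<Rightarrow> laakso_vertex pair_pre_digraph" where
  "laakso n = \<lparr>pverts = laakso_verts n, parcs = laakso_edges n \<union> (laakso_edges n)\<inverse>\<rparr>"

text \<open>
  The shortest-path distance \<open>\<mu>\<close> of the library takes values in the extended reals; it is
  finite on the vertices of \<open>laakso n\<close>, see \<open>laakso_dist_attained\<close> below.
\<close>

definition laakso_dist :: "nat \<Rightarrow> laakso_vertex \<Rightarrow> laakso_vertex \<Rightarrow> real" where
  "laakso_dist n a b = real_of_ereal (wf_digraph.\<mu> (with_proj (laakso n)) (\<lambda>_. 1) a b)"

definition L1_norm :: "'a measure \<Rightarrow> ('a \<Rightarrow> real) \<Rightarrow> real" where
  "L1_norm M g = (\<integral>x. \<bar>g x\<bar> \<partial>M)"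

lemma laakso_edges_verts: "laakso_edges n \<subseteq> laakso_verts n \<times> laakso_verts n"
proof (induction n)
  case (Suc n)
  then show ?case by fastforce
qed simp

lemma New_in_laakso_vertsD: "New k u v x \<in> laakso_verts n \<Longrightarrow> k < n"
proof (induction n)
  case (Suc n)
  have *: "k < Suc n" if "New k u v x = laakso_glue n u' v' y" "(u', v') \<in> laakso_edges n"
    for u' v' y
    using that Suc.IH laakso_edges_verts[of n] by (cases y) (auto simp: less_Suc_eq)
  from Suc.prems show ?case using Suc.IH * by (auto simp: less_Suc_eq)
qed simp

lemma laakso_glue_new:
  assumes "x \<notin> {LA, LU}"
  shows "laakso_glue n u v x \<notin> laakso_verts n"
  using assms New_in_laakso_vertsD[of n u v x n] by (cases x) auto

lemma laakso_edges_irrefl: "(u, v) \<in> laakso_edges n \<Longrightarrow> u \<noteq> v"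
proof (induction n arbitrary: u v)
  case (Suc n)
  then obtain a b x y where *: "(a, b) \<in> laakso_edges n" "(x, y) \<in> laakso_template"
    "u = laakso_glue n a b x" "v = laakso_glue n a b y"
    by auto
  have "a \<in> laakso_verts n" "b \<in> laakso_verts n"
    using * laakso_edges_verts by blast+
  then show ?case
    using * laakso_glue_new[of LT n a b] laakso_glue_new[of LB n a b]
    by (auto simp: laakso_template_def)
qed simp

lemma finite_laakso: "finite (laakso_verts n) \<and> finite (laakso_edges n)"
proof (induction n)
  case (Suc n)
  have "(UNIV :: laakso_pos set) = {LA, LT, LL, LR, LB, LU}"
    using laakso_pos.exhaust by auto
  then have fin: "finite (UNIV :: laakso_pos set)" by (metis finite.emptyI finite_insert)
  have "laakso_verts (Suc n) \<subseteq> laakso_verts n \<union>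
      (\<lambda>((u, v), x). laakso_glue n u v x) ` (laakso_edges n \<times> UNIV)"
    by force
  moreover have "finite \<dots>" using Suc fin by (intro finite_UnI finite_imageI finite_cartesian_product) auto
  ultimately have 1: "finite (laakso_verts (Suc n))" by (rule finite_subset)
  then have "finite (laakso_edges (Suc n))"
    by (metis finite_cartesian_product finite_subset laakso_edges_verts)
  with 1 show ?case by blast
qed simp

lemma pair_graph_laakso: "pair_graph (laakso n)"
  using laakso_edges_verts[of n] finite_laakso[of n]
  by unfold_locales
    (auto simp: laakso_def symmetric_def sym_def dest: laakso_edges_irrefl)

lemma laakso_edges_connected:
  assumes "v \<in> laakso_verts n"
  shows "(Source, v) \<in> (laakso_edges n \<union> (laakso_edges n)\<inverse>)\<^sup>*"
  using assms
proof (induction n arbitrary: v)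
  case 0
  then show ?case by auto
next
  case (Suc n)
  let ?S = "laakso_edges (Suc n) \<union> (laakso_edges (Suc n))\<inverse>"
  have copy: "(u, laakso_glue n u v x) \<in> ?S\<^sup>*" if uv: "(u, v) \<in> laakso_edges n" for u v x
  proof -
    let ?g = "laakso_glue n u v"
    have e: "(?g x, ?g y) \<in> ?S" if "(x, y) \<in> laakso_template" for x y
      using uv that by auto
    have s: "(u, New n u v LT) \<in> ?S" "(New n u v LT, New n u v LL) \<in> ?S"
      "(New n u v LT, New n u v LR) \<in> ?S" "(New n u v LL, New n u v LB) \<in> ?S"
      "(New n u v LB, v) \<in> ?S"
      using e[of LA LT] e[of LT LL] e[of LT LR] e[of LL LB] e[of LB LU]
      by (simp_all add: laakso_template_def del: laakso_edges.simps)
    have t: "(u, New n u v LT) \<in> ?S\<^sup>*" using s(1) by (rule r_into_rtrancl)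
    have l: "(u, New n u v LL) \<in> ?S\<^sup>*" using t s(2) by (rule rtrancl_into_rtrancl)
    have r: "(u, New n u v LR) \<in> ?S\<^sup>*" using t s(3) by (rule rtrancl_into_rtrancl)
    have b: "(u, New n u v LB) \<in> ?S\<^sup>*" using l s(4) by (rule rtrancl_into_rtrancl)
    have "(u, v) \<in> ?S\<^sup>*" using b s(5) by (rule rtrancl_into_rtrancl)
    with t l r b show ?thesis by (cases x) (simp_all del: laakso_edges.simps)
  qed
  have sym: "(a, b) \<in> ?S\<^sup>*" if "(b, a) \<in> ?S\<^sup>*" for a b
    using that by (metis converse_Un converse_converse rtrancl_converseI sup_commute)
  have sub: "laakso_edges n \<union> (laakso_edges n)\<inverse> \<subseteq> ?S\<^sup>*"
    using copy[where x = LU] sym by (auto simp del: laakso_edges.simps)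
  have old: "(Source, w) \<in> ?S\<^sup>*" if "w \<in> laakso_verts n" for w
    using Suc.IH[OF that] rtrancl_mono[OF sub] by (auto simp del: laakso_edges.simps)
  from Suc.prems consider "v \<in> laakso_verts n"
    | a b x where "(a, b) \<in> laakso_edges n" "v = laakso_glue n a b x"
    by auto
  then show ?case
  proof cases
    case 1
    then show ?thesis by (rule old)
  next
    case 2
    then have "a \<in> laakso_verts n" using laakso_edges_verts by blast
    from old[OF this] copy[OF 2(1)] show ?thesis
      unfolding 2(2) by (rule rtrancl_trans)
  qed
qed

lemma laakso_awalk_exists:
  assumes "a \<in> laakso_verts n" "b \<in> laakso_verts n"
  shows "\<exists>p. pre_digraph.awalk (with_proj (laakso n)) a p b"
proof -
  interpret pair_graph "laakso n" by (rule pair_graph_laakso)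
  let ?S = "laakso_edges n \<union> (laakso_edges n)\<inverse>"
  have walk: "\<exists>p. awalk x p y" if "(x, y) \<in> ?S\<^sup>*" "x \<in> laakso_verts n" for x y
    using that
  proof (induction rule: rtrancl_induct)
    case base
    then show ?case by (intro exI[of _ "[]"]) (simp add: awalk_Nil_iff, simp add: laakso_def)
  next
    case (step y z)
    then obtain p where "awalk x p y" by blast
    moreover have "awalk y [(y, z)] z"
      using step(2) laakso_edges_verts[of n] by (auto simp: awalk_def) (auto simp: laakso_def)
    ultimately show ?case by (blast intro: awalk_appendI)
  qed
  have "(a, Source) \<in> ?S\<^sup>*"
    using laakso_edges_connected[OF assms(1)]
    by (metis converse_Un converse_converse rtrancl_converseI sup_commute)
  with laakso_edges_connected[OF assms(2)] have "(a, b) \<in> ?S\<^sup>*" by (meson rtrancl_trans)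
  with walk assms(1) show ?thesis by blast
qed

lemma laakso_dist_attained:
  assumes "a \<in> laakso_verts n" "b \<in> laakso_verts n"
  obtains p where "pre_digraph.awalk (with_proj (laakso n)) a p b"
    "wf_digraph.\<mu> (with_proj (laakso n)) (\<lambda>_. 1) a b = ereal (length p)"
    "laakso_dist n a b = length p"
    "\<And>q. pre_digraph.awalk (with_proj (laakso n)) a q b \<Longrightarrow> length p \<le> length q"
proof -
  interpret pair_graph "laakso n" by (rule pair_graph_laakso)
  have cost: "awalk_cost (\<lambda>_. 1) q = real (length q)" for q :: "(laakso_vertex \<times> laakso_vertex) list"
    by (induction q) auto
  obtain p where p: "awalk a p b" "\<And>q. awalk a q b \<Longrightarrow> length p \<le> length q"
    using laakso_awalk_exists[OF assms] ex_has_least_nat[of "\<lambda>p. awalk a p b" _ length] by metis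
  have mu: "\<mu> (\<lambda>_. 1) a b = ereal (length p)"
    unfolding \<mu>_def cost using p by (intro antisym INF_greatest INF_lower2[of p]) auto
  show thesis
    using that[OF p(1) mu _ p(2)] mu by (simp add: laakso_dist_def)
qed

end

theory Submission
  imports Defs "HOL-Probability.Probability"
begin

text \<open>
  Choose a random cut of the graph, refining it level by level. A copy of the template whose
  end vertices lie on the same side of the cut is not cut. Otherwise one of four equally likely
  cuts is used, independently for different copies: through \<open>AT\<close>, through \<open>TL\<close> and \<open>RB\<close>,
  through \<open>TR\<close> and \<open>LB\<close>, or through \<open>BU\<close>. The \<open>L\<^sub>1\<close> distance of two vertices is \<open>4\<^sup>n\<close> times
  the probability that the cut separates them. Every edge is cut with probability \<open>4\<^sup>-\<^sup>n\<close>,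
  whence the upper bound. For the lower bound, consider the smallest copy containing both
  vertices. The distance is preserved exactly unless the vertices lie in diagonally opposite
  parts such as \<open>TL\<close> and \<open>RB\<close>; there, at relative heights \<open>\<alpha>\<close> and \<open>\<beta>\<close> in their parts,
  independence gives \<open>1 + \<alpha> + \<beta> - 2 * \<alpha> * \<beta>\<close> against \<open>min (1 + \<alpha> + \<beta>) (3 - \<alpha> - \<beta>)\<close>.
\<close>

section \<open>Independent choices\<close>

definition determined_by :: "'k set \<Rightarrow> ('k \<Rightarrow> 'v) set \<Rightarrow> bool" where
  "determined_by D W \<longleftrightarrow> (\<forall>c c'. (\<forall>i\<in>D. c i = c' i) \<longrightarrow> (c \<in> W \<longleftrightarrow> c' \<in> W))"

lemma determined_byD:
  "determined_by D W \<Longrightarrow> (\<And>i. i \<in> D \<Longrightarrow> c i = c' i) \<Longrightarrow> c \<in> W \<longleftrightarrow> c' \<in> W"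
  unfolding determined_by_def by blast

lemma determined_by_mono: "determined_by D W \<Longrightarrow> D \<subseteq> D' \<Longrightarrow> determined_by D' W"
  unfolding determined_by_def by blast

lemma determined_by_upd: "determined_by D W \<Longrightarrow> e \<notin> D \<Longrightarrow> c(e := i) \<in> W \<longleftrightarrow> c \<in> W"
  by (rule determined_byD) auto

text \<open>Splitting \<open>I\<close> along \<open>D1\<close> presents the product measure as the
  image of a pair of smaller products; \<open>W1\<close> reads only the first component and
  \<open>W2\<close> only the second.\<close>

lemma prob_Pi_pmf_Int:
  fixes p :: "'k \<Rightarrow> 'v pmf" and d :: 'v
  assumes fin: "finite I" and disj: "D1 \<inter> D2 = {}"
    and det: "determined_by D1 W1" "determined_by D2 W2"
  defines "M \<equiv> Pi_pmf I d p"
  shows "measure_pmf.prob M (W1 \<inter> W2) = measure_pmf.prob M W1 * measure_pmf.prob M W2"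
proof -
  define A B where "A = I \<inter> D1" and "B = I - D1"
  define MA MB where "MA = Pi_pmf A d p" and "MB = Pi_pmf B d p"
  define h where "h = (\<lambda>(f, g) x. if x \<in> A then f x else (g x :: 'v))"
  have finAB: "finite A" "finite B" using fin by (auto simp: A_def B_def)
  have I: "I = A \<union> B" "A \<inter> B = {}" by (auto simp: A_def B_def)
  have M: "M = map_pmf h (pair_pmf MA MB)"
    unfolding M_def MA_def MB_def h_def I(1) by (rule Pi_pmf_union[OF finAB I(2)])
  \<comment> \<open>\<open>D1\<close> may reach outside \<open>I\<close>; there
    \<open>h (f, g)\<close> and \<open>f\<close> agree because both factors take the default
    \<open>d\<close> off their index sets.\<close>
  have supp: "f x = d" if "f \<in> set_pmf MA" "x \<notin> A" for f x
    using set_Pi_pmf_subset[OF finAB(1), of d p] that unfolding MA_def by auto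
  have supp': "g x = d" if "g \<in> set_pmf MB" "x \<notin> B" for g x
    using set_Pi_pmf_subset[OF finAB(2), of d p] that unfolding MB_def by auto
  have split: "measure_pmf.prob M (V1 \<inter> V2) = measure_pmf.prob MA V1 * measure_pmf.prob MB V2"
    if V: "determined_by D1 V1" "determined_by D2 V2" for V1 V2
  proof -
    have mem1: "h (f, g) \<in> V1 \<longleftrightarrow> f \<in> V1" if "f \<in> set_pmf MA" "g \<in> set_pmf MB" for f g
      using supp[OF that(1)] supp'[OF that(2)]
      by (intro determined_byD[OF V(1)]) (auto simp: h_def A_def B_def)
    have mem2: "h (f, g) \<in> V2 \<longleftrightarrow> g \<in> V2" if "f \<in> set_pmf MA" "g \<in> set_pmf MB" for f g
      using disj by (intro determined_byD[OF V(2)]) (auto simp: h_def A_def B_def)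
    have "measure_pmf.prob M (V1 \<inter> V2)
        = measure_pmf.prob (pair_pmf MA MB) (h -` (V1 \<inter> V2) \<inter> set_pmf (pair_pmf MA MB))"
      unfolding M by (simp only: measure_Int_set_pmf measure_map_pmf)
    also have "h -` (V1 \<inter> V2) \<inter> set_pmf (pair_pmf MA MB)
        = (V1 \<inter> set_pmf MA) \<times> (V2 \<inter> set_pmf MB)"
      using mem1 mem2 by auto
    also have "measure_pmf.prob (pair_pmf MA MB) \<dots> = measure_pmf.prob MA V1 * measure_pmf.prob MB V2"
      by (subst measure_pmf_prob_product) (auto simp: measure_Int_set_pmf)
    finally show ?thesis .
  qed
  \<comment> \<open>With \<open>UNIV\<close> as one of the events, \<open>split\<close> identifies
    the two factors as the probabilities of \<open>W1\<close> and \<open>W2\<close>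
    themselves.\<close>
  have "determined_by D1 UNIV" "determined_by D2 UNIV"
    by (auto simp: determined_by_def)
  from split[OF det(1) this(2)] split[OF this(1) det(2)] split[OF det] show ?thesis
    by simp
qed

abbreviation uniform4 :: "'k set \<Rightarrow> ('k \<Rightarrow> nat) pmf" where
  "uniform4 I \<equiv> Pi_pmf I 0 (\<lambda>_. pmf_of_set {..<4})"

text \<open>Law of total probability over the coordinate \<open>e\<close>: once \<open>e\<close> is
  overwritten by \<open>i\<close>, the event no longer looks at \<open>e\<close> and is independent
  of \<open>c e = i\<close>.\<close>

lemma prob_uniform4_split:
  assumes fin: "finite I" and e: "e \<in> I"
  shows "measure_pmf.prob (uniform4 I) W
    = (measure_pmf.prob (uniform4 I) {c. c(e := 0) \<in> W}
      + measure_pmf.prob (uniform4 I) {c. c(e := 1) \<in> W}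
      + measure_pmf.prob (uniform4 I) {c. c(e := 2) \<in> W}
      + measure_pmf.prob (uniform4 I) {c. c(e := 3) \<in> W}) / 4"
proof -
  let ?P = "measure_pmf.prob (uniform4 I)"
  have comp: "map_pmf (\<lambda>c. c e) (uniform4 I) = pmf_of_set {..<4}"
    using e by (simp add: Pi_pmf_component[OF fin])
  have coord: "?P {c. c e = i} = 1/4" if "i < 4" for i
  proof -
    have "?P {c. c e = i} = measure_pmf.prob (map_pmf (\<lambda>c. c e) (uniform4 I)) {i}"
      by (simp add: vimage_def)
    also have "\<dots> = 1/4" unfolding comp using that by (simp add: measure_pmf_single lessThan_empty_iff)
    finally show ?thesis .
  qed
  have "c e < 4" if "c \<in> set_pmf (uniform4 I)" for c
  proof -
    have "c e \<in> set_pmf (map_pmf (\<lambda>c. c e) (uniform4 I))" using that by simp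
    then show ?thesis unfolding comp by (simp add: lessThan_empty_iff)
  qed
  then have "?P W = ?P (\<Union>i<4. {c. c e = i} \<inter> {c. c(e := i) \<in> W})"
    by (intro measure_pmf.finite_measure_eq_AE) (auto simp: AE_measure_pmf_iff)
  also have "\<dots> = (\<Sum>i<4. ?P ({c. c e = i} \<inter> {c. c(e := i) \<in> W}))"
    by (rule measure_pmf.finite_measure_finite_Union) (auto simp: disjoint_family_on_def)
  also have "\<dots> = (\<Sum>i<4. ?P {c. c e = i} * ?P {c. c(e := i) \<in> W})"
  proof (rule sum.cong[OF refl])
    fix i
    have upd: "c(e := i) = c'(e := i)" if "\<forall>j\<in>- {e}. c j = c' j" for c c' :: "'a \<Rightarrow> nat"
      using that by auto
    show "?P ({c. c e = i} \<inter> {c. c(e := i) \<in> W}) = ?P {c. c e = i} * ?P {c. c(e := i) \<in> W}"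
      by (rule prob_Pi_pmf_Int[OF fin, of "{e}" "- {e}"])
        (auto simp: determined_by_def dest: upd)
  qed
  also have "\<dots> = (\<Sum>i<4. ?P {c. c(e := i) \<in> W}) / 4"
    by (simp add: coord sum_divide_distrib)
  also have "(\<Sum>i<4. ?P {c. c(e := i) \<in> W})
      = ?P {c. c(e := 0) \<in> W} + ?P {c. c(e := 1) \<in> W} + ?P {c. c(e := 2) \<in> W} + ?P {c. c(e := 3) \<in> W}"
    by (simp add: eval_nat_numeral)
  finally show ?thesis .
qed

section \<open>Realizing a finite uniform space on the unit interval\<close>

text \<open>\<open>X\<close> runs through \<open>A\<close> on consecutive intervals of equal length.
  One \<open>X\<close> serves all \<open>\<phi>\<close>, hence all vertices at once.\<close>

lemma L1_realization:
  assumes fin: "finite A" and ne: "A \<noteq> {}"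
  obtains X :: "real \<Rightarrow> 'a" where
    "\<forall>\<phi> :: 'a \<Rightarrow> real. has_bochner_integral (lebesgue_on {0..1}) (\<lambda>t. \<phi> (X t))
        (measure_pmf.expectation (pmf_of_set A) \<phi>)"
proof -
  define N where "N = card A"
  have N: "N > 0" using fin ne by (simp add: N_def card_gt_0_iff)
  obtain \<omega> where \<omega>: "bij_betw \<omega> {..<N} A"
    using ex_bij_betw_nat_finite[OF fin] by (auto simp: N_def atLeast0LessThan)
  define X where "X = (\<lambda>t::real. \<omega> (nat \<lfloor>real N * t\<rfloor>))"
  \<comment> \<open>The floor reaches \<open>N\<close> at \<open>t = 1\<close>, where
    \<open>X\<close> may leave \<open>A\<close>. This index is kept as the null set
    \<open>J N = {1}\<close>, so the sums in \<open>main\<close> run over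
    \<open>i \<le> N\<close>.\<close>
  define J where "J = (\<lambda>i. {t. i / N \<le> t \<and> t < (i + 1) / N} \<inter> {0..1::real})"
  let ?L = "lebesgue_on {0..1::real}"
  have mem_J: "t \<in> J (real i) \<longleftrightarrow> nat \<lfloor>real N * t\<rfloor> = i" if "t \<in> {0..1}" for t i
  proof -
    have "t \<in> J (real i) \<longleftrightarrow> real i \<le> N * t \<and> N * t < i + 1"
      using N that by (auto simp: J_def field_simps)
    also have "\<dots> \<longleftrightarrow> \<lfloor>real N * t\<rfloor> = int i" by (auto simp: floor_eq_iff)
    also have "\<dots> \<longleftrightarrow> nat \<lfloor>real N * t\<rfloor> = i"
      using that by auto
    finally show ?thesis .
  qed
  have J_sets: "J i \<in> sets ?L" for i
  proof -
    have "{t. i / N \<le> t \<and> t < (i + 1) / N} = {i / N..<(i + 1) / N}" by auto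
    then have "J i \<in> sets lebesgue" by (simp add: J_def)
    then show ?thesis by (simp add: sets_restrict_space_iff J_def)
  qed
  have J_measure: "measure ?L (J (real i)) = (if i < N then 1 / N else 0)" if "i \<le> N" for i
  proof -
    have "measure ?L (J (real i)) = measure lebesgue (J (real i))"
      using J_sets[of i] by (intro measure_restrict_space) (auto simp: J_def)
    moreover have "J (real i) = (if i < N then {real i / N..<(real i + 1) / N} else {1})"
    proof (cases "i < N")
      case True
      then have "(real i + 1) / N \<le> 1" by (simp add: field_simps)
      moreover have "0 \<le> real i / N" by simp
      ultimately have "t \<in> J (real i) \<longleftrightarrow> real i / N \<le> t \<and> t < (real i + 1) / N" for t
        unfolding J_def Int_iff mem_Collect_eq atLeastAtMost_iff by linarith
      then have "J (real i) = {real i / N..<(real i + 1) / N}" by (intro set_eqI) simp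
      then show ?thesis using True by simp
    next
      case False
      with that have "i = N" by simp
      then have "t \<in> J (real i) \<longleftrightarrow> t = 1" for t using N by (auto simp: J_def divide_simps)
      then show ?thesis using \<open>i = N\<close> by auto
    qed
    moreover have "measure lebesgue {real i / N..<(real i + 1) / N} = 1 / N"
      using N by (simp add: add_divide_distrib divide_right_mono)
    ultimately show ?thesis by simp
  qed
  have repr: "has_bochner_integral ?L (\<lambda>t. \<phi> (X t)) (\<Sum>i<N. \<phi> (\<omega> i) / N)" for \<phi> :: "'a \<Rightarrow> real"
  proof -
    have fm: "emeasure ?L (J i) < \<infinity>" for i
      using finite_measure.emeasure_finite[OF finite_measure_lebesgue_on, of "{0..1}" "J i"]
      by (simp add: less_top)
    have main: "has_bochner_integral ?L (\<lambda>t. \<Sum>i\<le>N. indicator (J (real i)) t *\<^sub>R \<phi> (\<omega> i))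
        (\<Sum>i\<le>N. measure ?L (J (real i)) *\<^sub>R \<phi> (\<omega> i))"
      using J_sets fm by (intro has_bochner_integral_sum has_bochner_integral_indicator) auto
    have pointwise: "(\<Sum>i\<le>N. indicator (J (real i)) t *\<^sub>R \<phi> (\<omega> i)) = \<phi> (X t)" if "t \<in> space ?L" for t
    proof -
      from that have t: "t \<in> {0..1}" by (simp add: space_restrict_space)
      have "real N * t \<le> real N" using t by (simp add: mult_left_le)
      then have "\<lfloor>real N * t\<rfloor> \<le> int N" by (simp add: floor_le_iff)
      then have "nat \<lfloor>real N * t\<rfloor> \<le> N" by simp
      then show ?thesis using mem_J[OF t] by (simp add: indicator_def X_def if_distrib[of "\<lambda>x. x * _"] cong: if_cong)
    qed
    have sums: "(\<Sum>i\<le>N. measure ?L (J (real i)) *\<^sub>R \<phi> (\<omega> i)) = (\<Sum>i<N. \<phi> (\<omega> i) / N)"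
      by (simp add: J_measure lessThan_Suc_atMost[symmetric])
    show ?thesis
      by (rule iffD1[OF has_bochner_integral_cong[OF refl pointwise sums] main])
  qed
  have "(\<Sum>i<N. \<phi> (\<omega> i) / N) = measure_pmf.expectation (pmf_of_set A) \<phi>" for \<phi> :: "'a \<Rightarrow> real"
    using sum.reindex_bij_betw[OF \<omega>, of \<phi>] fin ne
    by (simp add: integral_pmf_of_set N_def sum_divide_distrib[symmetric])
  with repr that[of X] show thesis by simp
qed

section \<open>Recursive structure of the Laakso graphs\<close>

text \<open>
  Unlike \<open>laakso_edges\<close>, which refines every edge of the previous level, the following
  recursions first replace the edge \<open>uv\<close> of level \<open>k\<close> by a template and then refine each of its
  six edges \<open>m\<close> times. The keys \<open>(j, a, b)\<close> name the copies created on the way.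
\<close>

fun subedges :: "nat \<Rightarrow> nat \<Rightarrow> laakso_vertex \<Rightarrow> laakso_vertex \<Rightarrow> laakso_vertex rel" where
  "subedges k 0 u v = {(u, v)}"
| "subedges k (Suc m) u v = (\<Union>(x, y)\<in>laakso_template.
    subedges (Suc k) m (laakso_glue k u v x) (laakso_glue k u v y))"

fun subkeys :: "nat \<Rightarrow> nat \<Rightarrow> laakso_vertex \<Rightarrow> laakso_vertex
    \<Rightarrow> (nat \<times> laakso_vertex \<times> laakso_vertex) set" where
  "subkeys k 0 u v = {}"
| "subkeys k (Suc m) u v = insert (k, u, v) (\<Union>(x, y)\<in>laakso_template.
    subkeys (Suc k) m (laakso_glue k u v x) (laakso_glue k u v y))"

text \<open>The level that creates the vertex. Bounds on it are the freshness invariant: ends of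
  birth at most \<open>k\<close> differ from all vertices tagged \<open>k\<close>.\<close>

primrec birth :: "laakso_vertex \<Rightarrow> nat" where
  "birth Source = 0"
| "birth Sink = 0"
| "birth (New k u v x) = Suc k"

lemma birth_glue: "birth u \<le> k \<Longrightarrow> birth v \<le> k \<Longrightarrow> birth (laakso_glue k u v x) \<le> Suc k"
  by (cases x) auto

lemma laakso_template_cases:
  assumes "(x, y) \<in> laakso_template"
  obtains "x = LA" "y = LT" | "x = LT" "y = LL" | "x = LT" "y = LR"
    | "x = LL" "y = LB" | "x = LR" "y = LB" | "x = LB" "y = LU"
  using assms by (auto simp: laakso_template_def)

text \<open>Every template edge has an inner end, whose tag records \<open>u\<close> and
  \<open>v\<close>; the birth bounds keep it apart from the old ends.\<close>

lemma glue_edge_inj: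
  assumes "(x, y) \<in> laakso_template" "(x', y') \<in> laakso_template"
    and "birth u \<le> k" "birth v \<le> k" "birth u' \<le> k" "birth v' \<le> k"
    and "laakso_glue k u v x = laakso_glue k u' v' x'"
    and "laakso_glue k u v y = laakso_glue k u' v' y'"
  shows "u = u' \<and> v = v' \<and> x = x' \<and> y = y'"
  using assms(1)
  by (cases rule: laakso_template_cases;
      use assms(2) in \<open>cases rule: laakso_template_cases; use assms(3-) in auto\<close>)

lemma finite_subkeys: "finite (subkeys k m u v)"
  by (induction m arbitrary: k u v) (auto simp: laakso_template_def)

lemma subkeys_level: "(j, e) \<in> subkeys k m u v \<Longrightarrow> k \<le> j"
proof (induction m arbitrary: k u v)
  case (Suc m)
  then show ?case by (auto dest!: Suc.IH)
qed simp

text \<open>Makes choices in different copies independent. The root keys differ, deeper keys have a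
  larger level, and subcopies stay distinct by \<open>glue_edge_inj\<close>.\<close>

lemma subkeys_disjoint:
  assumes "birth u \<le> k" "birth v \<le> k" "birth u' \<le> k" "birth v' \<le> k" "(u, v) \<noteq> (u', v')"
  shows "subkeys k m u v \<inter> subkeys k m u' v' = {}"
  using assms
proof (induction m arbitrary: k u v u' v')
  case (Suc m)
  let ?g = "laakso_glue k u v" and ?g' = "laakso_glue k u' v'"
  have "subkeys (Suc k) m (?g x) (?g y) \<inter> subkeys (Suc k) m (?g' x') (?g' y') = {}"
    if "(x, y) \<in> laakso_template" "(x', y') \<in> laakso_template" for x y x' y'
  proof (rule Suc.IH)
    show "(?g x, ?g y) \<noteq> (?g' x', ?g' y')"
      using glue_edge_inj[OF that Suc.prems(1-4)] Suc.prems(5) by auto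
  qed (use Suc.prems birth_glue in auto)
  moreover have "(k, e) \<notin> subkeys (Suc k) m w w'" for e w w'
    using subkeys_level by fastforce
  ultimately show ?case using Suc.prems(5) by fastforce
qed simp

text \<open>Connects refining last with refining first: the induction moves one step from
  \<open>m\<close> to \<open>k\<close>.\<close>

lemma laakso_edges_add:
  "laakso_edges (k + m) = (\<Union>(u, v)\<in>laakso_edges k. subedges k m u v)"
proof (induction m arbitrary: k)
  case (Suc m)
  have "laakso_edges (Suc k + m) = (\<Union>(u, v)\<in>laakso_edges (Suc k). subedges (Suc k) m u v)"
    by (rule Suc.IH)
  also have "\<dots> = (\<Union>(u, v)\<in>laakso_edges k. subedges k (Suc m) u v)"
    by fastforce
  finally show ?case by simp
qed auto

lemma laakso_edges_eq_subedges: "laakso_edges n = subedges 0 n Source Sink"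
  using laakso_edges_add[of 0 n] by simp

text \<open>Lets every vertex be located through an edge containing it; no template position is
  isolated.\<close>

lemma laakso_verts_eq_Field: "laakso_verts n = Field (laakso_edges n)"
proof (induction n)
  case (Suc n)
  have edge: "laakso_glue n u v x \<in> Field (laakso_edges (Suc n))" if "(u, v) \<in> laakso_edges n" for u v x
  proof -
    obtain y where "(x, y) \<in> laakso_template \<or> (y, x) \<in> laakso_template"
      by (cases x) (auto simp: laakso_template_def)
    then have "(laakso_glue n u v x, laakso_glue n u v y) \<in> laakso_edges (Suc n)
        \<or> (laakso_glue n u v y, laakso_glue n u v x) \<in> laakso_edges (Suc n)"
      using that by auto
    then show ?thesis by (meson FieldI1 FieldI2)
  qed
  have "laakso_verts n \<subseteq> Field (laakso_edges (Suc n))"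
  proof
    fix w assume "w \<in> laakso_verts n"
    then obtain w' where "(w, w') \<in> laakso_edges n \<or> (w', w) \<in> laakso_edges n"
      unfolding Suc.IH by (auto simp: Field_def)
    then show "w \<in> Field (laakso_edges (Suc n))"
      using edge[of w w' LA] edge[of w' w LU] by auto
  qed
  with edge have "laakso_verts (Suc n) \<subseteq> Field (laakso_edges (Suc n))" by auto
  moreover have "Field (laakso_edges (Suc n)) \<subseteq> laakso_verts (Suc n)"
    using laakso_edges_verts[of "Suc n"] by (fastforce simp: Field_def)
  ultimately show ?case by blast
qed (auto simp: Field_def)

section \<open>Order and directed paths in the template\<close>

text \<open>Directed distance from \<open>LA\<close>. It is also the number of choices in
  \<open>{..<4}\<close> that lie in the \<open>sink_side\<close> of the position, which is what
  turns probabilities into heights.\<close>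

fun template_rank :: "laakso_pos \<Rightarrow> nat" where
  "template_rank LA = 0" | "template_rank LT = 1" | "template_rank LL = 2" | "template_rank LR = 2" | "template_rank LB = 3" | "template_rank LU = 4"

text \<open>
  The choices \<open>0, 1, 2, 3\<close> for a copy mean cutting \<open>AT\<close>, \<open>TL\<close> with \<open>RB\<close>, \<open>TR\<close> with \<open>LB\<close>, and
  \<open>BU\<close>. A position takes the side of the \<open>LU\<close> end exactly for the choices in its
  \<open>sink_side\<close>; \<open>UNIV\<close> at \<open>LU\<close> makes \<open>cut_glue\<close> hold for out-of-range choices too.
\<close>

fun sink_side :: "laakso_pos \<Rightarrow> nat set" where
  "sink_side LA = {}"
| "sink_side LT = {0}"
| "sink_side LL = {0, 1}"
| "sink_side LR = {0, 2}"
| "sink_side LB = {0, 1, 2}"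
| "sink_side LU = UNIV"

text \<open>Inclusion of sink sides serves as the reachability order of the template, in which only
  \<open>LL\<close> and \<open>LR\<close> are incomparable.\<close>

lemma template_path:
  assumes "sink_side x \<subseteq> sink_side y"
  shows "template_rank x \<le> template_rank y" "(x, y) \<in> laakso_template ^^ (template_rank y - template_rank x)"
proof -
  have edges [simp]: "(LA, LT) \<in> laakso_template" "(LT, LL) \<in> laakso_template"
    "(LT, LR) \<in> laakso_template" "(LL, LB) \<in> laakso_template"
    "(LR, LB) \<in> laakso_template" "(LB, LU) \<in> laakso_template"
    by (simp_all add: laakso_template_def)
  have paths [simp]: "laakso_template ^^ 2 = {(LA, LL), (LA, LR), (LT, LB), (LL, LU), (LR, LU)}"
    "laakso_template ^^ 3 = {(LA, LB), (LT, LU)}"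
    "laakso_template ^^ 4 = {(LA, LU)}"
    by (auto simp: eval_nat_numeral relcomp_unfold laakso_template_def)
  \<comment> \<open>Testing the four choices decides the inclusion for concrete positions; choice 3
    tells \<open>LU\<close> from the rest.\<close>
  have "0 \<in> sink_side x \<longrightarrow> 0 \<in> sink_side y" "1 \<in> sink_side x \<longrightarrow> 1 \<in> sink_side y"
    "2 \<in> sink_side x \<longrightarrow> 2 \<in> sink_side y" "3 \<in> sink_side x \<longrightarrow> 3 \<in> sink_side y"
    using assms by blast+
  then have "template_rank x \<le> template_rank y \<and> (x, y) \<in> laakso_template ^^ (template_rank y - template_rank x)"
    by (cases x; cases y) simp_all
  then show "template_rank x \<le> template_rank y" "(x, y) \<in> laakso_template ^^ (template_rank y - template_rank x)" by auto
qed

lemma sink_side_edge: "(x, y) \<in> laakso_template \<Longrightarrow> sink_side x \<subseteq> sink_side y"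
  by (auto simp: laakso_template_def)

lemma rank_edge: "(x, y) \<in> laakso_template \<Longrightarrow> template_rank y = Suc (template_rank x)"
  by (auto simp: laakso_template_def)

lemma subedges_step:
  "(x, y) \<in> laakso_template \<Longrightarrow>
    subedges (Suc k) m (laakso_glue k u v x) (laakso_glue k u v y) \<subseteq> subedges k (Suc m) u v"
  by auto

lemma relpow_subset: "(R :: 'a rel) \<subseteq> S \<Longrightarrow> R ^^ d \<subseteq> S ^^ d"
  by (induction d) (simp_all add: relcomp_mono)

lemma relpow_mult_edge:
  fixes R :: "'a rel" and S :: "'b rel"
  assumes "\<And>x y. (x, y) \<in> R \<Longrightarrow> (g x, g y) \<in> S ^^ K"
  shows "(x, y) \<in> R ^^ d \<Longrightarrow> (g x, g y) \<in> S ^^ (d * K)"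
proof (induction d arbitrary: y)
  case (Suc d)
  then obtain z where "(x, z) \<in> R ^^ d" "(z, y) \<in> R" by auto
  with Suc.IH assms have "(g x, g y) \<in> S ^^ (d * K) O S ^^ K" by blast
  then show ?case by (simp add: relpow_add[symmetric] add.commute)
qed simp

lemma subedges_through: "(u, v) \<in> subedges k m u v ^^ (4 ^ m)"
proof (induction m arbitrary: k u v)
  case (Suc m)
  let ?g = "laakso_glue k u v"
  have "(?g LA, ?g LU) \<in> subedges k (Suc m) u v ^^ (4 * 4 ^ m)"
  proof (rule relpow_mult_edge[where R = laakso_template and g = ?g])
    show "(?g x, ?g y) \<in> subedges k (Suc m) u v ^^ (4 ^ m)" if "(x, y) \<in> laakso_template" for x y
      using Suc.IH relpow_subset[OF subedges_step[OF that]] by blast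
    show "(LA, LU) \<in> laakso_template ^^ 4"
      using template_path[of LA LU] by simp
  qed
  then show ?case by simp
qed simp

lemma subedges_path:
  assumes "sink_side x \<subseteq> sink_side y"
  shows "(laakso_glue k u v x, laakso_glue k u v y)
    \<in> subedges k (Suc m) u v ^^ ((template_rank y - template_rank x) * 4 ^ m)"
  using template_path(2)[OF assms] subedges_through relpow_subset[OF subedges_step]
  by (intro relpow_mult_edge[where R = laakso_template]) blast+

section \<open>The random cut and the events describing it\<close>

text \<open>A \<open>New\<close> vertex stores the edge it refines, so its side follows from the
  choices alone. If \<open>u\<close> and \<open>v\<close> are on the same side, both branches agree
  and the copy stays uncut.\<close>

primrec laakso_cut :: "(nat \<times> laakso_vertex \<times> laakso_vertex \<Rightarrow> nat) \<Rightarrow> laakso_vertex \<Rightarrow> bool" where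
  "laakso_cut c Source = False"
| "laakso_cut c Sink = True"
| "laakso_cut c (New k u v x) = (if c (k, u, v) \<in> sink_side x then laakso_cut c v else laakso_cut c u)"

lemma cut_glue:
  "laakso_cut c (laakso_glue k u v x) = (if c (k, u, v) \<in> sink_side x then laakso_cut c v else laakso_cut c u)"
  by (cases x) auto

text \<open>
  The event \<open>W\<close> describes the side of \<open>a\<close> relative to \<open>u\<close> and \<open>v\<close>, using only the choices made
  inside the copy of \<open>uv\<close>.
\<close>

definition represents where
  "represents k m u v a W \<longleftrightarrow> determined_by (subkeys k m u v) W \<and>
    (\<forall>c. laakso_cut c a = laakso_cut c (if c \<in> W then v else u))"

text \<open>Choices in \<open>sink_side x\<close> put both ends of the subedge with
  \<open>v\<close>; those only in \<open>sink_side y\<close> cut it, so \<open>W\<close> decides;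
  the rest put both ends with \<open>u\<close>.\<close>

definition graft :: "'k \<Rightarrow> laakso_pos \<Rightarrow> laakso_pos \<Rightarrow> ('k \<Rightarrow> nat) set \<Rightarrow> ('k \<Rightarrow> nat) set" where
  "graft e x y W = {c. c e \<in> sink_side x \<or> c \<in> W \<and> c e \<in> sink_side y}"

lemma represents_graft:
  assumes xy: "(x, y) \<in> laakso_template"
    and W: "represents (Suc k) m (laakso_glue k u v x) (laakso_glue k u v y) a W"
  shows "represents k (Suc m) u v a (graft (k, u, v) x y W)"
proof -
  have "determined_by (subkeys k (Suc m) u v) W"
    using W xy by (auto simp: represents_def elim!: determined_by_mono)
  then have "determined_by (subkeys k (Suc m) u v) (graft (k, u, v) x y W)"
    unfolding determined_by_def graft_def by (auto; metis)
  moreover have "laakso_cut c a = laakso_cut c (if c \<in> graft (k, u, v) x y W then v else u)" for c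
    using W sink_side_edge[OF xy] by (auto simp: represents_def graft_def cut_glue)
  ultimately show ?thesis by (simp add: represents_def)
qed

section \<open>Separation probabilities\<close>

abbreviation symm :: "'a rel \<Rightarrow> 'a rel" where
  "symm R \<equiv> R \<union> R\<inverse>"

lemma relpow_symm_sym: "(a, b) \<in> symm R ^^ l \<Longrightarrow> (b, a) \<in> symm R ^^ l"
proof (induction l arbitrary: b)
  case (Suc l)
  then obtain z where "(a, z) \<in> symm R ^^ l" "(z, b) \<in> symm R" by auto
  then have "(b, z) \<in> symm R" "(z, a) \<in> symm R ^^ l" using Suc.IH by auto
  then show ?case by (rule relpow_Suc_I2)
qed simp

lemma relpow_trans: "(a, b) \<in> R ^^ i \<Longrightarrow> (b, c) \<in> R ^^ j \<Longrightarrow> (a, c) \<in> R ^^ (i + j)"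
  by (auto simp: relpow_add)

lemma relpow_symmI: "(a, b) \<in> R ^^ l \<Longrightarrow> R \<subseteq> S \<Longrightarrow> (a, b) \<in> symm S ^^ l"
  using relpow_subset[of R "symm S" l] by auto

context
  fixes I :: "(nat \<times> laakso_vertex \<times> laakso_vertex) set"
  assumes fin: "finite I"
begin

abbreviation prob where "prob W \<equiv> measure_pmf.prob (uniform4 I) W"

text \<open>For events representing two vertices of a copy, the event measured is that the cut
  separates them whenever it separates the ends of the copy.\<close>

definition sep where "sep V W = prob {c. (c \<in> V) \<noteq> (c \<in> W)}"

lemma sep_commute: "sep V W = sep W V"
  unfolding sep_def by (intro arg_cong[where f = prob]) auto

lemma sep_subset: "V \<subseteq> W \<Longrightarrow> sep V W = prob W - prob V"
proof -
  assume "V \<subseteq> W"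
  then have "{c. (c \<in> V) \<noteq> (c \<in> W)} = W - V" by auto
  with \<open>V \<subseteq> W\<close> show ?thesis by (simp add: sep_def measure_pmf.finite_measure_Diff)
qed

lemma sep_independent:
  assumes "determined_by D V" "determined_by D' W" "D \<inter> D' = {}"
  shows "sep V W = prob V + prob W - 2 * (prob V * prob W)"
proof -
  have "{c. (c \<in> V) \<noteq> (c \<in> W)} = (V \<union> W) - (V \<inter> W)" by auto
  then have "sep V W = prob (V \<union> W) - prob (V \<inter> W)"
    by (simp add: sep_def measure_pmf.finite_measure_Diff Int_Un_distrib le_infI1)
  also have "prob (V \<union> W) = prob V + prob W - prob (V \<inter> W)"
    using measure_pmf.finite_measure_Union'[of V "uniform4 I" W]
      measure_pmf.finite_measure_Diff'[of W "uniform4 I" V]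
    by (simp add: Int_commute)
  also have "prob (V \<inter> W) = prob V * prob W"
    by (rule prob_Pi_pmf_Int[OF fin assms(3,1,2)])
  finally show ?thesis by simp
qed

lemma prob_compl: "prob {c. c \<notin> V} = 1 - prob V"
  using measure_pmf.prob_compl[of V "uniform4 I"] by (simp add: Compl_eq[symmetric] Compl_eq_Diff_UNIV)

lemma graft_upd:
  "determined_by D W \<Longrightarrow> e \<notin> D \<Longrightarrow>
    c(e := i) \<in> graft e x y W \<longleftrightarrow> i \<in> sink_side x \<or> c \<in> W \<and> i \<in> sink_side y"
  by (simp add: graft_def determined_by_upd)

text \<open>Of the four choices, \<open>template_rank x\<close> put the vertex on the sink side for
  sure, and exactly one cuts the subedge and leaves the decision to \<open>W\<close>.\<close>

lemma prob_graft:
  assumes "(x, y) \<in> laakso_template" "e \<in> I" "determined_by D W" "e \<notin> D"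
  shows "prob (graft e x y W) = (template_rank x + prob W) / 4"
  unfolding prob_uniform4_split[OF fin assms(2), of "graft e x y W"]
  unfolding graft_upd[OF assms(3,4)]
  using assms(1) by (cases rule: laakso_template_cases) simp_all

lemma sep_graft:
  assumes "e \<in> I" "determined_by D V" "e \<notin> D" "determined_by D' W" "e \<notin> D'"
  defines "Q \<equiv> \<lambda>x y x' y' i. prob {c. (i \<in> sink_side x \<or> c \<in> V \<and> i \<in> sink_side y)
    \<noteq> (i \<in> sink_side x' \<or> c \<in> W \<and> i \<in> sink_side y')}"
  shows "sep (graft e x y V) (graft e x' y' W)
    = (Q x y x' y' 0 + Q x y x' y' 1 + Q x y x' y' 2 + Q x y x' y' 3) / 4"
  unfolding sep_def prob_uniform4_split[OF fin assms(1), of "{c. (c \<in> graft e x y V) \<noteq> (c \<in> graft e x' y' W)}"]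
  unfolding mem_Collect_eq graft_upd[OF assms(2,3)] graft_upd[OF assms(4,5)] Q_def ..

text \<open>Only the one choice that cuts the subedge can separate two vertices inside it.\<close>

lemma sep_graft_same:
  assumes "(x, y) \<in> laakso_template"
    "e \<in> I" "determined_by D V" "e \<notin> D" "determined_by D' W" "e \<notin> D'"
  shows "sep (graft e x y V) (graft e x y W) = sep V W / 4"
  unfolding sep_graft[OF assms(2-)]
  using assms(1) by (cases rule: laakso_template_cases) (simp_all add: sep_def)

lemma subkeys_step:
  assumes "(x, y) \<in> laakso_template"
  shows "subkeys (Suc k) m (laakso_glue k u v x) (laakso_glue k u v y) \<subseteq> subkeys k (Suc m) u v"
  using assms by auto

lemma not_in_subkeys_Suc: "(k, e) \<notin> subkeys (Suc k) m u v"
  using subkeys_level by fastforce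

text \<open>An edge is nested in \<open>m\<close> templates, and each contributes a factor
  \<open>1 / 4\<close>.\<close>

lemma edge_sep:
  assumes "(a, b) \<in> subedges k m u v" "subkeys k m u v \<subseteq> I"
  shows "\<exists>V W. represents k m u v a V \<and> represents k m u v b W \<and> sep V W = 1 / 4 ^ m"
  using assms
proof (induction m arbitrary: k u v)
  case 0
  then show ?case
    by (intro exI[of _ "{}"] exI[of _ UNIV]) (simp add: represents_def determined_by_def sep_def)
next
  case (Suc m)
  let ?g = "laakso_glue k u v"
  from Suc.prems(1) obtain x y where xy: "(x, y) \<in> laakso_template"
    "(a, b) \<in> subedges (Suc k) m (?g x) (?g y)" by auto
  have "subkeys (Suc k) m (?g x) (?g y) \<subseteq> I"
    using Suc.prems(2) subkeys_step[OF xy(1)] by blast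
  moreover have "(k, u, v) \<in> I" using Suc.prems(2) by simp
  ultimately have I: "subkeys (Suc k) m (?g x) (?g y) \<subseteq> I" "(k, u, v) \<in> I" .
  obtain V W where VW: "represents (Suc k) m (?g x) (?g y) a V"
    "represents (Suc k) m (?g x) (?g y) b W" "sep V W = 1 / 4 ^ m"
    using Suc.IH[OF xy(2) I(1)] by blast
  have "sep (graft (k, u, v) x y V) (graft (k, u, v) x y W) = sep V W / 4"
    using VW(1,2) by (intro sep_graft_same[OF xy(1) I(2)]) (auto simp: represents_def not_in_subkeys_Suc)
  then have "sep (graft (k, u, v) x y V) (graft (k, u, v) x y W) = 1 / 4 ^ Suc m"
    using VW(3) by simp
  then show ?case
    using represents_graft[OF xy(1) VW(1)] represents_graft[OF xy(1) VW(2)] by blast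
qed

text \<open>Every vertex lies on a directed path of length \<open>4 ^ m\<close> between the ends,
  and its height there is exactly proportional to its probability of falling on the sink
  side.\<close>

lemma vertex_height:
  assumes "a \<in> Field (subedges k m u v)" "subkeys k m u v \<subseteq> I"
  obtains W i j where "represents k m u v a W" "real i = 4 ^ m * prob W" "i + j = 4 ^ m"
    "(u, a) \<in> subedges k m u v ^^ i" "(a, v) \<in> subedges k m u v ^^ j"
proof -
  have "\<exists>W i j. represents k m u v a W \<and> real i = 4 ^ m * prob W \<and> i + j = 4 ^ m \<and>
    (u, a) \<in> subedges k m u v ^^ i \<and> (a, v) \<in> subedges k m u v ^^ j"
    using assms
  proof (induction m arbitrary: k u v)
    case 0
    then consider "a = u" | "a = v" by (auto simp: Field_def)
    then show ?case
    proof cases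
      case 1
      then show ?thesis
        by (intro exI[of _ "{}"] exI[of _ 0] exI[of _ 1]) (simp add: represents_def determined_by_def)
    next
      case 2
      then show ?thesis
        by (intro exI[of _ UNIV] exI[of _ 1] exI[of _ 0]) (simp add: represents_def determined_by_def)
    qed
  next
    case (Suc m)
    let ?g = "laakso_glue k u v"
    from Suc.prems(1) obtain x y where xy: "(x, y) \<in> laakso_template"
      "a \<in> Field (subedges (Suc k) m (?g x) (?g y))" by (auto simp: Field_def)
    have "subkeys (Suc k) m (?g x) (?g y) \<subseteq> I"
      using Suc.prems(2) subkeys_step[OF xy(1)] by blast
    moreover have "(k, u, v) \<in> I" using Suc.prems(2) by simp
    ultimately have I: "subkeys (Suc k) m (?g x) (?g y) \<subseteq> I" "(k, u, v) \<in> I" .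
    let ?S = "subedges (Suc k) m (?g x) (?g y)" and ?T = "subedges k (Suc m) u v"
    obtain W i j where W: "represents (Suc k) m (?g x) (?g y) a W" "real i = 4 ^ m * prob W"
      "i + j = 4 ^ m" "(?g x, a) \<in> ?S ^^ i" "(a, ?g y) \<in> ?S ^^ j"
      using Suc.IH[OF xy(2) I(1)] by blast
    have sub: "?S ^^ l \<subseteq> ?T ^^ l" for l
      by (rule relpow_subset[OF subedges_step[OF xy(1)]])
    have ends: "(u, ?g x) \<in> ?T ^^ (template_rank x * 4 ^ m)" "(?g y, v) \<in> ?T ^^ ((4 - template_rank y) * 4 ^ m)"
      using subedges_path[of LA x k u v m] subedges_path[of y LU k u v m] by simp_all
    have walks: "(u, a) \<in> ?T ^^ (template_rank x * 4 ^ m + i)" "(a, v) \<in> ?T ^^ (j + (4 - template_rank y) * 4 ^ m)"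
      by (rule relpow_trans[OF ends(1) subsetD[OF sub W(4)]],
          rule relpow_trans[OF subsetD[OF sub W(5)] ends(2)])
    have "prob (graft (k, u, v) x y W) = (template_rank x + prob W) / 4"
      using W(1) by (intro prob_graft[OF xy(1) I(2)]) (auto simp: represents_def not_in_subkeys_Suc)
    then have "4 ^ Suc m * prob (graft (k, u, v) x y W) = 4 ^ m * (template_rank x + prob W)"
      by simp
    then have "real (template_rank x * 4 ^ m + i) = 4 ^ Suc m * prob (graft (k, u, v) x y W)"
      by (simp add: W(2) algebra_simps del: power_Suc)
    moreover have "template_rank x * 4 ^ m + i + (j + (4 - template_rank y) * 4 ^ m) = 4 ^ Suc m"
    proof -
      \<comment> \<open>The parts below, inside and above the subedge take up four units of length
        \<open>4 ^ m\<close>.\<close>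
      have "template_rank x + 1 + (4 - template_rank y) = 4"
        using xy(1) by (cases rule: laakso_template_cases) simp_all
      then have "(template_rank x + 1 + (4 - template_rank y)) * 4 ^ m = 4 * 4 ^ m" by (rule arg_cong)
      then show ?thesis using W(3) by (simp add: algebra_simps)
    qed
    ultimately show ?case using walks represents_graft[OF xy(1) W(1)] by blast
  qed
  then show thesis using that by blast
qed

section \<open>The lower bound inside a copy\<close>

text \<open>Any walk of length \<open>l\<close> bounds the distance from above, so no walk has to be
  shown shortest.\<close>

definition well_separated where
  "well_separated k m u v a b \<longleftrightarrow> (\<exists>V W l. represents k m u v a V \<and> represents k m u v b W \<and>
    (a, b) \<in> symm (subedges k m u v) ^^ l \<and> 3 / 4 * real l \<le> 4 ^ m * sep V W)"

lemma well_separatedI: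
  assumes "represents k m u v a V" "represents k m u v b W"
    "(a, b) \<in> symm (subedges k m u v) ^^ l" "3 / 4 * real l \<le> 4 ^ m * sep V W"
  shows "well_separated k m u v a b"
  using assms unfolding well_separated_def by blast

lemma well_separatedI_isometric:
  assumes "represents k m u v a V" "represents k m u v b W"
    "(a, b) \<in> symm (subedges k m u v) ^^ l" "4 ^ m * sep V W = real l"
  shows "well_separated k m u v a b"
  by (rule well_separatedI[OF assms(1-3)]) (simp add: assms(4))

lemma well_separated_sym: "well_separated k m u v a b \<Longrightarrow> well_separated k m u v b a"
  unfolding well_separated_def using relpow_symm_sym sep_commute by metis

text \<open>Two distinct template edges follow one another on a directed path, branch at
  \<open>LT\<close>, meet at \<open>LB\<close>, or are diagonally opposite on the cycle.\<close>

lemma template_pair_cases [consumes 2, case_names same before after fork join cross cross']: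
  assumes "(x, y) \<in> laakso_template" "(x', y') \<in> laakso_template"
  obtains "x = x'" "y = y'" | "sink_side y \<subseteq> sink_side x'" | "sink_side y' \<subseteq> sink_side x"
    | "x = LT" "x' = LT" "{y, y'} = {LL, LR}" | "{x, x'} = {LL, LR}" "y = LB" "y' = LB"
    | "x = LT" "y' = LB" "{y, x'} = {LL, LR}" | "x' = LT" "y = LB" "{y', x} = {LL, LR}"
proof -
  have "(x = x' \<and> y = y') \<or> sink_side y \<subseteq> sink_side x' \<or> sink_side y' \<subseteq> sink_side x
    \<or> (x = LT \<and> x' = LT \<and> {y, y'} = {LL, LR}) \<or> ({x, x'} = {LL, LR} \<and> y = LB \<and> y' = LB)
    \<or> (x = LT \<and> y' = LB \<and> {y, x'} = {LL, LR}) \<or> (x' = LT \<and> y = LB \<and> {y', x} = {LL, LR})"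
    using assms(1)
    by (cases rule: laakso_template_cases;
        use assms(2) in \<open>cases rule: laakso_template_cases; simp add: doubleton_eq_iff\<close>)
  then show thesis by (elim disjE conjE) (rule that; assumption)+
qed

text \<open>
  The extremal case: for \<open>s = \<alpha> + \<beta>\<close>, AM-GM bounds \<open>2 * \<alpha> * \<beta>\<close> by \<open>s\<^sup>2 / 2\<close>, and equality
  in the result holds at \<open>\<alpha> = \<beta> = 1 / 2\<close>.
\<close>

lemma cross_inequality:
  fixes \<alpha> \<beta> :: real
  assumes "0 \<le> \<alpha>" "\<alpha> \<le> 1" "0 \<le> \<beta>" "\<beta> \<le> 1"
  shows "3 / 4 * min (1 + \<alpha> + \<beta>) (3 - \<alpha> - \<beta>) \<le> 1 + (\<alpha> + \<beta> - 2 * (\<alpha> * \<beta>))"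
proof -
  define s where "s = \<alpha> + \<beta>"
  have "0 \<le> (\<alpha> - \<beta>)\<^sup>2" by simp
  then have amgm: "4 * (\<alpha> * \<beta>) \<le> s\<^sup>2" by (simp add: s_def power2_eq_square algebra_simps)
  have s: "0 \<le> s" "s \<le> 2" using assms by (auto simp: s_def)
  show ?thesis
  proof (cases "s \<le> 1")
    case True
    have "0 \<le> (1 - s) * (1 + 2 * s)" using True s by simp
    then have "2 * s\<^sup>2 \<le> 1 + s" by (simp add: power2_eq_square algebra_simps)
    moreover have "min (1 + \<alpha> + \<beta>) (3 - \<alpha> - \<beta>) \<le> 1 + s" by (simp add: s_def)
    ultimately show ?thesis using amgm unfolding s_def by argo
  next
    case False
    have "0 \<le> (5 - 2 * s) * (s - 1)" using False s by simp
    then have "2 * s\<^sup>2 \<le> 7 * s - 5" by (simp add: power2_eq_square algebra_simps)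
    moreover have "min (1 + \<alpha> + \<beta>) (3 - \<alpha> - \<beta>) \<le> 3 - s" by (simp add: s_def)
    ultimately show ?thesis using amgm unfolding s_def by argo
  qed
qed

text \<open>The induction descends while both vertices share a subcopy. Once they part,
  \<open>vertex_height\<close> supplies walk lengths and probabilities in matching units.\<close>

lemma well_separated_subedges:
  assumes "a \<in> Field (subedges k m u v)" "b \<in> Field (subedges k m u v)"
    and "subkeys k m u v \<subseteq> I" "birth u \<le> k" "birth v \<le> k"
  shows "well_separated k m u v a b"
  using assms
proof (induction m arbitrary: k u v)
  case 0
  \<comment> \<open>Testing against \<open>u\<close> also covers the degenerate case
    \<open>u = v\<close>.\<close>
  let ?W = "\<lambda>w. if w = u then {} else (UNIV :: (nat \<times> laakso_vertex \<times> laakso_vertex \<Rightarrow> nat) set)"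
  from 0 have ab: "a = u \<or> a = v" "b = u \<or> b = v" by (auto simp: Field_def)
  show ?case
  proof (rule well_separatedI)
    show "represents k 0 u v a (?W a)" "represents k 0 u v b (?W b)"
      using ab by (auto simp: represents_def determined_by_def)
    show "(a, b) \<in> symm (subedges k 0 u v) ^^ (if a = b then 0 else 1)"
      using ab by auto
    show "3 / 4 * real (if a = b then 0 else 1) \<le> 4 ^ 0 * sep (?W a) (?W b)"
      using ab by (auto simp: sep_def)
  qed
next
  case (Suc m)
  let ?g = "laakso_glue k u v" and ?e = "(k, u, v)"
  let ?S = "\<lambda>x y. subedges (Suc k) m (?g x) (?g y)" and ?T = "subedges k (Suc m) u v"
  let ?D = "\<lambda>x y. subkeys (Suc k) m (?g x) (?g y)"
  let ?K = "4 ^ m :: nat"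
  have e: "?e \<in> I" using Suc.prems(3) by auto
  have D: "?D x y \<subseteq> I" if "(x, y) \<in> laakso_template" for x y
    using Suc.prems(3) subkeys_step[OF that] by blast
  have sub: "(p, q) \<in> symm ?T ^^ l" if "(x, y) \<in> laakso_template" "(p, q) \<in> ?S x y ^^ l" for x y p q l
    by (rule relpow_symmI[OF that(2) subedges_step[OF that(1)]])
  have edge: "(?g x, ?g y) \<in> symm ?T ^^ ?K" if "(x, y) \<in> laakso_template" for x y
    by (rule sub[OF that subedges_through])
  have rep: "determined_by (?D x y) W" "?e \<notin> ?D x y" if "represents (Suc k) m (?g x) (?g y) w W" for w W x y
    using that by (auto simp: represents_def not_in_subkeys_Suc)
  have before_far: "well_separated k (Suc m) u v a b"
    if xy: "(x, y) \<in> laakso_template" "a \<in> Field (?S x y)"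
      and xy': "(x', y') \<in> laakso_template" "b \<in> Field (?S x' y')"
      and less: "sink_side y \<subseteq> sink_side x'" for a b x y x' y'
  proof -
    obtain V i j where V: "represents (Suc k) m (?g x) (?g y) a V" "real i = 4 ^ m * prob V"
        "i + j = ?K" "(?g x, a) \<in> ?S x y ^^ i" "(a, ?g y) \<in> ?S x y ^^ j"
      using vertex_height[OF xy(2) D[OF xy(1)]] by blast
    obtain W i' j' where W: "represents (Suc k) m (?g x') (?g y') b W" "real i' = 4 ^ m * prob W"
        "i' + j' = ?K" "(?g x', b) \<in> ?S x' y' ^^ i'" "(b, ?g y') \<in> ?S x' y' ^^ j'"
      using vertex_height[OF xy'(2) D[OF xy'(1)]] by blast
    define d where "d = template_rank x' - template_rank y"
    have d: "real (template_rank x') = real (template_rank x) + 1 + real d"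
      using template_path(1)[OF less] rank_edge[OF xy(1)] by (simp add: d_def)
    have mid: "(?g y, ?g x') \<in> symm ?T ^^ (d * ?K)"
      unfolding d_def by (rule relpow_symmI[OF subedges_path[OF less] subset_refl])
    have walk: "(a, b) \<in> symm ?T ^^ (j + d * ?K + i')"
      by (rule relpow_trans[OF relpow_trans[OF sub[OF xy(1) V(5)] mid] sub[OF xy'(1) W(4)]])
    \<comment> \<open>A choice that can put \<open>a\<close> on the sink side lies in
      \<open>sink_side y\<close>, so it puts \<open>b\<close> there for sure. Nested events make the
      separation a difference of heights.\<close>
    have "graft ?e x y V \<subseteq> graft ?e x' y' W"
      using less sink_side_edge[OF xy(1)] by (auto simp: graft_def)
    then have "sep (graft ?e x y V) (graft ?e x' y' W) = (template_rank x' + prob W) / 4 - (template_rank x + prob V) / 4"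
      by (simp only: sep_subset prob_graft[OF xy(1) e rep[OF V(1)]] prob_graft[OF xy'(1) e rep[OF W(1)]])
    then have "4 * sep (graft ?e x y V) (graft ?e x' y' W) = 1 - prob V + d + prob W"
      unfolding d by argo
    then have "4 ^ Suc m * sep (graft ?e x y V) (graft ?e x' y' W) = ?K * (1 - prob V + d + prob W)"
      by simp
    also have "\<dots> = real (j + d * ?K + i')"
      using V(2) W(2) arg_cong[OF V(3), of real] by (simp add: algebra_simps)
    finally have "4 ^ Suc m * sep (graft ?e x y V) (graft ?e x' y' W) = real (j + d * ?K + i')" .
    then show ?thesis
      by (rule well_separatedI_isometric[OF represents_graft[OF xy(1) V(1)] represents_graft[OF xy'(1) W(1)] walk])
  qed
  have cross_far: "well_separated k (Suc m) u v a b"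
    if xy: "(x, y) \<in> laakso_template" "a \<in> Field (?S x y)"
      and xy': "(x', y') \<in> laakso_template" "b \<in> Field (?S x' y')"
      and c: "x = LT" "y' = LB" "{y, x'} = {LL, LR}" for a b x y x' y'
  proof -
    obtain V i j where V: "represents (Suc k) m (?g x) (?g y) a V" "real i = 4 ^ m * prob V"
        "i + j = ?K" "(?g x, a) \<in> ?S x y ^^ i" "(a, ?g y) \<in> ?S x y ^^ j"
      using vertex_height[OF xy(2) D[OF xy(1)]] by blast
    obtain W i' j' where W: "represents (Suc k) m (?g x') (?g y') b W" "real i' = 4 ^ m * prob W"
        "i' + j' = ?K" "(?g x', b) \<in> ?S x' y' ^^ i'" "(b, ?g y') \<in> ?S x' y' ^^ j'"
      using vertex_height[OF xy'(2) D[OF xy'(1)]] by blast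
    have t: "(x, x') \<in> laakso_template" "(y, y') \<in> laakso_template"
      using c xy xy' by (auto simp: laakso_template_def doubleton_eq_iff)
    \<comment> \<open>The two ways around the cycle: back through \<open>LT\<close>, or onward
      through \<open>LB\<close>.\<close>
    have walk1: "(a, b) \<in> symm ?T ^^ (i + ?K + i')"
      by (rule relpow_trans[OF relpow_trans[OF
          relpow_symm_sym[OF sub[OF xy(1) V(4)]] edge[OF t(1)]] sub[OF xy'(1) W(4)]])
    have walk2: "(a, b) \<in> symm ?T ^^ (j + ?K + j')"
      by (rule relpow_trans[OF relpow_trans[OF
          sub[OF xy(1) V(5)] edge[OF t(2)]] relpow_symm_sym[OF sub[OF xy'(1) W(5)]]])
    have "?D x y \<inter> ?D x' y' = {}"
    proof (rule subkeys_disjoint)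
      show "(?g x, ?g y) \<noteq> (?g x', ?g y')"
        using c by (auto simp: doubleton_eq_iff)
    qed (use Suc.prems(4,5) birth_glue in auto)
    then have "sep V W = prob V + prob W - 2 * (prob V * prob W)"
      by (rule sep_independent[OF rep(1)[OF V(1)] rep(1)[OF W(1)]])
    \<comment> \<open>One choice cuts both subedges and leaves \<open>sep V W\<close>; one cuts the
      other two sides of the cycle and separates for sure; the remaining two never separate.\<close>
    moreover have "sep (graft ?e x y V) (graft ?e x' y' W) = (1 + sep V W) / 4"
      unfolding sep_graft[OF e rep[OF V(1)] rep[OF W(1)]]
      using c by (auto simp: doubleton_eq_iff sep_def)
    ultimately have s: "4 ^ Suc m * sep (graft ?e x y V) (graft ?e x' y' W)
        = ?K * (1 + (prob V + prob W - 2 * (prob V * prob W)))"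
      by simp
    have "3 / 4 * min (1 + prob V + prob W) (3 - prob V - prob W)
        \<le> 1 + (prob V + prob W - 2 * (prob V * prob W))"
      by (rule cross_inequality) auto
    then have "?K * (3 / 4 * min (1 + prob V + prob W) (3 - prob V - prob W))
        \<le> 4 ^ Suc m * sep (graft ?e x y V) (graft ?e x' y' W)"
      unfolding s by (rule mult_left_mono) simp
    also have "?K * (3 / 4 * min (1 + prob V + prob W) (3 - prob V - prob W))
        = 3 / 4 * real (min (i + ?K + i') (j + ?K + j'))"
    proof -
      have "real (i + ?K + i') = ?K * (1 + prob V + prob W)"
        "real (j + ?K + j') = ?K * (3 - prob V - prob W)"
        using V(2) W(2) arg_cong[OF V(3), of real] arg_cong[OF W(3), of real]
        by (simp_all add: algebra_simps)
      moreover have "?K * min (1 + prob V + prob W) (3 - prob V - prob W)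
          = min (?K * (1 + prob V + prob W)) (?K * (3 - prob V - prob W))"
        by (simp add: min_mult_distrib_left)
      ultimately show ?thesis by (simp only: of_nat_min mult.left_commute)
    qed
    finally show ?thesis
      using walk1 walk2
      by (intro well_separatedI[OF represents_graft[OF xy(1) V(1)] represents_graft[OF xy'(1) W(1)]])
        (auto simp: min_def)
  qed
  from Suc.prems(1) obtain x y where xy: "(x, y) \<in> laakso_template" "a \<in> Field (?S x y)"
    by (auto simp: Field_def)
  from Suc.prems(2) obtain x' y' where xy': "(x', y') \<in> laakso_template" "b \<in> Field (?S x' y')"
    by (auto simp: Field_def)
  obtain V i j where V: "represents (Suc k) m (?g x) (?g y) a V" "real i = 4 ^ m * prob V"
      "i + j = ?K" "(?g x, a) \<in> ?S x y ^^ i" "(a, ?g y) \<in> ?S x y ^^ j"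
    using vertex_height[OF xy(2) D[OF xy(1)]] by blast
  obtain W i' j' where W: "represents (Suc k) m (?g x') (?g y') b W" "real i' = 4 ^ m * prob W"
      "i' + j' = ?K" "(?g x', b) \<in> ?S x' y' ^^ i'" "(b, ?g y') \<in> ?S x' y' ^^ j'"
    using vertex_height[OF xy'(2) D[OF xy'(1)]] by blast
  from xy(1) xy'(1) show ?case
  proof (cases rule: template_pair_cases)
    case same
    have "birth (?g x) \<le> Suc k" "birth (?g y) \<le> Suc k" using Suc.prems(4,5) birth_glue by auto
    then have "well_separated (Suc k) m (?g x) (?g y) a b"
      using Suc.IH[OF xy(2) _ D[OF xy(1)]] xy'(2) same by blast
    then obtain V W l where VW: "represents (Suc k) m (?g x) (?g y) a V"
      "represents (Suc k) m (?g x) (?g y) b W"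
      "(a, b) \<in> symm (?S x y) ^^ l" "3 / 4 * real l \<le> 4 ^ m * sep V W"
      unfolding well_separated_def by blast
    have "symm (?S x y) \<subseteq> symm ?T" using subedges_step[OF xy(1)] by blast
    then have "(a, b) \<in> symm ?T ^^ l" using VW(3) relpow_subset by blast
    \<comment> \<open>The extra factor 4 in the scale cancels the loss in
      \<open>sep\<close>.\<close>
    moreover have "4 ^ Suc m * sep (graft ?e x y V) (graft ?e x y W) = 4 ^ m * sep V W"
      using sep_graft_same[OF xy(1) e rep[OF VW(1)] rep[OF VW(2)]] by simp
    ultimately show ?thesis using VW(4)
      by (intro well_separatedI[OF represents_graft[OF xy(1) VW(1)] represents_graft[OF xy(1) VW(2)]])
        (simp_all only:)
  next
    case before
    then show ?thesis by (rule before_far[OF xy xy'])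
  next
    case after
    then show ?thesis by (rule well_separated_sym[OF before_far[OF xy' xy]])
  next
    case fork
    have walk: "(a, b) \<in> symm ?T ^^ (i + i')"
    proof (rule relpow_trans)
      show "(a, ?g LT) \<in> symm ?T ^^ i"
        using relpow_symm_sym[OF sub[OF xy(1) V(4)]] fork by simp
      show "(?g LT, b) \<in> symm ?T ^^ i'"
        using sub[OF xy'(1) W(4)] fork by simp
    qed
    \<comment> \<open>Different choices cut the two subedges, and the uncut side stays with
      \<open>u\<close>, so the heights above \<open>LT\<close> add up.\<close>
    have "sep (graft ?e x y V) (graft ?e x' y' W) = (prob V + prob W) / 4"
      unfolding sep_graft[OF e rep[OF V(1)] rep[OF W(1)]]
      using fork by (auto simp: doubleton_eq_iff)
    then have "4 ^ Suc m * sep (graft ?e x y V) (graft ?e x' y' W) = ?K * (prob V + prob W)"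
      by simp
    then have "4 ^ Suc m * sep (graft ?e x y V) (graft ?e x' y' W) = real (i + i')"
      using V(2) W(2) by (simp add: distrib_left del: power_Suc)
    then show ?thesis
      by (rule well_separatedI_isometric[OF represents_graft[OF xy(1) V(1)] represents_graft[OF xy'(1) W(1)] walk])
  next
    case join
    have walk: "(a, b) \<in> symm ?T ^^ (j + j')"
    proof (rule relpow_trans)
      show "(a, ?g LB) \<in> symm ?T ^^ j"
        using sub[OF xy(1) V(5)] join by simp
      show "(?g LB, b) \<in> symm ?T ^^ j'"
        using relpow_symm_sym[OF sub[OF xy'(1) W(5)]] join by simp
    qed
    \<comment> \<open>Mirror image of the fork: the uncut side is with \<open>v\<close>, so
      complements enter, the depths below \<open>LB\<close>.\<close>
    have "sep (graft ?e x y V) (graft ?e x' y' W) = (2 - prob V - prob W) / 4"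
      unfolding sep_graft[OF e rep[OF V(1)] rep[OF W(1)]]
      using join by (auto simp: doubleton_eq_iff prob_compl)
    then have "4 ^ Suc m * sep (graft ?e x y V) (graft ?e x' y' W) = ?K * (2 - prob V - prob W)"
      by simp
    also have "\<dots> = real (j + j')"
      using V(2) W(2) arg_cong[OF V(3), of real] arg_cong[OF W(3), of real] by (simp add: algebra_simps)
    finally have "4 ^ Suc m * sep (graft ?e x y V) (graft ?e x' y' W) = real (j + j')" .
    then show ?thesis
      by (rule well_separatedI_isometric[OF represents_graft[OF xy(1) V(1)] represents_graft[OF xy'(1) W(1)] walk])
  next
    case cross
    then show ?thesis by (rule cross_far[OF xy xy'])
  next
    case cross'
    then show ?thesis by (rule well_separated_sym[OF cross_far[OF xy' xy]])
  qed
qed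

end

section \<open>Passage to the shortest-path metric and to functions\<close>

lemma laakso_awalk_of_relpow:
  assumes "(a, b) \<in> symm (laakso_edges n) ^^ l" "a \<in> laakso_verts n"
  shows "\<exists>p. pre_digraph.awalk (with_proj (laakso n)) a p b \<and> length p = l"
proof -
  interpret pair_graph "laakso n" by (rule pair_graph_laakso)
  show ?thesis using assms(1)
  proof (induction l arbitrary: b)
    case 0
    then show ?case using assms(2) by (simp add: awalk_Nil_iff) (simp add: laakso_def)
  next
    case (Suc l)
    then obtain z where z: "(a, z) \<in> symm (laakso_edges n) ^^ l" "(z, b) \<in> symm (laakso_edges n)"
      by auto
    from Suc.IH[OF z(1)] obtain p where p: "awalk a p z" "length p = l" by blast
    have "awalk z [(z, b)] b"
      using z(2) laakso_edges_verts[of n] by (auto simp: awalk_def) (auto simp: laakso_def)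
    with p have "awalk a (p @ [(z, b)]) b" by (blast intro: awalk_appendI)
    with p(2) show ?case by (intro exI[of _ "p @ [(z, b)]"]) simp
  qed
qed

text \<open>\<open>Source\<close> and \<open>Sink\<close> are always separated, so at the top level
  \<open>sep\<close> is the actual separation probability.\<close>

lemma sep_represents:
  assumes "finite I" "represents 0 n Source Sink a V" "represents 0 n Source Sink b W"
  shows "sep I V W = measure_pmf.prob (uniform4 I) {c. laakso_cut c a \<noteq> laakso_cut c b}"
proof -
  have "{c. (c \<in> V) \<noteq> (c \<in> W)} = {c. laakso_cut c a \<noteq> laakso_cut c b}"
    using assms(2,3) by (auto simp: represents_def)
  then show ?thesis by (simp add: sep_def[OF assms(1)])
qed

text \<open>Separation probability obeys the triangle inequality, so the exact value on edges adds
  up along any walk.\<close>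

lemma laakso_cut_lipschitz:
  assumes "finite I" "subkeys 0 n Source Sink \<subseteq> I"
    and "pre_digraph.awalk (with_proj (laakso n)) a p b"
  shows "4 ^ n * measure_pmf.prob (uniform4 I) {c. laakso_cut c a \<noteq> laakso_cut c b} \<le> length p"
proof -
  interpret pair_graph "laakso n" by (rule pair_graph_laakso)
  let ?P = "\<lambda>a b. measure_pmf.prob (uniform4 I) {c. laakso_cut c a \<noteq> laakso_cut c b}"
  have comm: "?P a b = ?P b a" for a b
    by (intro arg_cong[where f = "measure_pmf.prob (uniform4 I)"]) auto
  have edge: "4 ^ n * ?P a b = 1" if ab: "(a, b) \<in> laakso_edges n" for a b
  proof -
    obtain V W where VW: "represents 0 n Source Sink a V" "represents 0 n Source Sink b W"
      "sep I V W = 1 / 4 ^ n"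
      using edge_sep[OF assms(1) ab[unfolded laakso_edges_eq_subedges] assms(2)] by blast
    then show ?thesis using sep_represents[OF assms(1) VW(1,2)] by simp
  qed
  have step: "4 ^ n * ?P a b \<le> 1" if "(a, b) \<in> parcs (laakso n)" for a b
    using that edge[of a b] edge[of b a] comm[of a b] by (auto simp: laakso_def)
  have triangle: "?P a b \<le> ?P a z + ?P z b" for a z b
  proof -
    have "?P a b \<le> measure_pmf.prob (uniform4 I)
        ({c. laakso_cut c a \<noteq> laakso_cut c z} \<union> {c. laakso_cut c z \<noteq> laakso_cut c b})"
      by (intro measure_pmf.finite_measure_mono) auto
    also have "\<dots> \<le> ?P a z + ?P z b"
      by (rule measure_Un_le) auto
    finally show ?thesis .
  qed
  show ?thesis using assms(3)
  proof (induction p arbitrary: a)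
    case Nil
    then show ?case by (simp add: awalk_Nil_iff)
  next
    case (Cons e p)
    then obtain z where z: "e = (a, z)" "(a, z) \<in> parcs (laakso n)" "awalk z p b"
      by (cases e) (auto simp: awalk_Cons_iff)
    have "4 ^ n * ?P a b \<le> 4 ^ n * (?P a z + ?P z b)"
      by (intro mult_left_mono triangle) simp
    also have "\<dots> = 4 ^ n * ?P a z + 4 ^ n * ?P z b" by (rule distrib_left)
    also have "\<dots> \<le> 1 + real (length p)" using step[OF z(2)] Cons.IH[OF z(3)] by (rule add_mono)
    finally show ?case by simp
  qed
qed

lemma laakso_cut_expansion:
  assumes "finite I" "subkeys 0 n Source Sink \<subseteq> I"
    and "a \<in> laakso_verts n" "b \<in> laakso_verts n"
  shows "3 / 4 * laakso_dist n a b
    \<le> 4 ^ n * measure_pmf.prob (uniform4 I) {c. laakso_cut c a \<noteq> laakso_cut c b}"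
proof -
  have "well_separated I 0 n Source Sink a b"
    using assms(3,4)
    by (intro well_separated_subedges[OF assms(1) _ _ assms(2)])
      (simp_all add: laakso_verts_eq_Field laakso_edges_eq_subedges)
  then obtain V W l where VW: "represents 0 n Source Sink a V" "represents 0 n Source Sink b W"
    "(a, b) \<in> symm (laakso_edges n) ^^ l" "3 / 4 * real l \<le> 4 ^ n * sep I V W"
    unfolding well_separated_def[OF assms(1)] laakso_edges_eq_subedges by blast
  have "laakso_dist n a b \<le> real l"
  proof -
    obtain q where q: "pre_digraph.awalk (with_proj (laakso n)) a q b" "length q = l"
      using laakso_awalk_of_relpow[OF VW(3) assms(3)] by blast
    show ?thesis
    proof (rule laakso_dist_attained[OF assms(3,4)])
      fix p
      assume "laakso_dist n a b = length p"
        and "\<And>q. pre_digraph.awalk (with_proj (laakso n)) a q b \<Longrightarrow> length p \<le> length q"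
      with q show "laakso_dist n a b \<le> real l" by auto
    qed
  qed
  then have "3 / 4 * laakso_dist n a b \<le> 3 / 4 * real l" by simp
  also have "\<dots> \<le> 4 ^ n * sep I V W" by (rule VW(4))
  finally show ?thesis unfolding sep_represents[OF assms(1) VW(1,2)] .
qed

theorem theorem8:
  fixes n :: nat
  assumes "n \<ge> 1"
  shows "\<exists>f :: laakso_vertex \<Rightarrow> real \<Rightarrow> real.
    (\<forall>a \<in> pverts (laakso n). integrable (lebesgue_on {0..1}) (f a)) \<and>
    (\<forall>a \<in> pverts (laakso n). \<forall>b \<in> pverts (laakso n).
       3 / 4 * laakso_dist n a b \<le> L1_norm (lebesgue_on {0..1}) (\<lambda>x. f a x - f b x) \<and>
       L1_norm (lebesgue_on {0..1}) (\<lambda>x. f a x - f b x) \<le> laakso_dist n a b)"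
proof -
  define I where "I = subkeys 0 n Source Sink"
  have I: "finite I" "subkeys 0 n Source Sink \<subseteq> I" by (simp_all add: I_def finite_subkeys)
  \<comment> \<open>The product of uniform choices is uniform on a finite set of functions, as
    \<open>L1_realization\<close> requires; the default 0 off \<open>I\<close> keeps that set
    finite.\<close>
  define \<Omega> where "\<Omega> = PiE_dflt I 0 (\<lambda>_. {..<4::nat})"
  have \<Omega>: "uniform4 I = pmf_of_set \<Omega>"
    unfolding \<Omega>_def using I(1) by (intro Pi_pmf_of_set) (auto simp: lessThan_empty_iff)
  have "finite \<Omega>" unfolding \<Omega>_def using I(1) by (intro finite_PiE_dflt) auto
  moreover have "\<Omega> \<noteq> {}" unfolding \<Omega>_def by (auto simp: PiE_dflt_def intro!: exI[of _ "\<lambda>_. 0"])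
  ultimately obtain X :: "real \<Rightarrow> _" where X: "\<forall>\<phi> :: _ \<Rightarrow> real.
      has_bochner_integral (lebesgue_on {0..1}) (\<lambda>t. \<phi> (X t)) (measure_pmf.expectation (uniform4 I) \<phi>)"
    unfolding \<Omega> by (rule L1_realization)
  \<comment> \<open>Scaled indicators of the sink side: two of them differ in absolute value by
    \<open>4 ^ n\<close> exactly where the cut separates the vertices.\<close>
  define f :: "laakso_vertex \<Rightarrow> real \<Rightarrow> real"
    where "f = (\<lambda>a t. 4 ^ n * of_bool (laakso_cut (X t) a))"
  have norm: "L1_norm (lebesgue_on {0..1}) (\<lambda>t. f a t - f b t)
      = 4 ^ n * measure_pmf.prob (uniform4 I) {c. laakso_cut c a \<noteq> laakso_cut c b}" for a b
  proof -
    let ?D = "{c. laakso_cut c a \<noteq> laakso_cut c b}"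
    have "\<bar>f a t - f b t\<bar> = 4 ^ n * indicator ?D (X t)" for t
      by (auto simp: f_def)
    then have "L1_norm (lebesgue_on {0..1}) (\<lambda>t. f a t - f b t)
        = measure_pmf.expectation (uniform4 I) (\<lambda>c. 4 ^ n * indicator ?D c)"
      using has_bochner_integral_integral_eq[OF X[rule_format, of "\<lambda>c. 4 ^ n * indicator ?D c"]]
      by (simp only: L1_norm_def)
    then show ?thesis by simp
  qed
  have "integrable (lebesgue_on {0..1}) (f a)" for a
    using X[rule_format, of "\<lambda>c. 4 ^ n * of_bool (laakso_cut c a)"]
    unfolding f_def has_bochner_integral_iff by simp
  moreover have "3 / 4 * laakso_dist n a b \<le> L1_norm (lebesgue_on {0..1}) (\<lambda>x. f a x - f b x)"
    "L1_norm (lebesgue_on {0..1}) (\<lambda>x. f a x - f b x) \<le> laakso_dist n a b"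
    if ab: "a \<in> pverts (laakso n)" "b \<in> pverts (laakso n)" for a b
  proof -
    have v: "a \<in> laakso_verts n" "b \<in> laakso_verts n" using ab by (simp_all add: laakso_def)
    show "3 / 4 * laakso_dist n a b \<le> L1_norm (lebesgue_on {0..1}) (\<lambda>x. f a x - f b x)"
      unfolding norm by (rule laakso_cut_expansion[OF I v])
    obtain p where "pre_digraph.awalk (with_proj (laakso n)) a p b" "laakso_dist n a b = length p"
      by (rule laakso_dist_attained[OF v])
    then show "L1_norm (lebesgue_on {0..1}) (\<lambda>x. f a x - f b x) \<le> laakso_dist n a b"
      unfolding norm using laakso_cut_lipschitz[OF I] by simp
  qed
  ultimately show ?thesis by blast
qed

end
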